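(* Let $F:\mathbb{N}\to\mathbb{C}$ be an arithmetical function that is bounded and completely multiplicative. Then the Dirichlet inverse $\widetilde F$ of $F$ is supported on the set of squarefree numbers; that is, $\widetilde F(n)=0$ for every $n\in\mathbb{N}$ that is not squarefree.
   Context: $\mathbb{N}$ denotes the set of positive integers. A completely multiplicative function satisfies $F(1)=1$ and $F(mn)=F(m)F(n)$ for all $m,n\in\mathbb{N}$. For an arithmetical function $F:\mathbb{N}\to\mathbb{C}$ with $F(1)\ne 0$, the Dirichlet inverse $\widetilde F$ is the arithmetical function determined by $\sum_{ab=n}F(a)\widetilde F(b)=I(n)$ for all $n\in\mathbb{N}$, where $I(1)=1$ and $I(n)=0$ for $n\ge 2$. *)

theory Defs
  imports "HOL-Analysis.Analysis" "HOL-Computational_Algebra.Squarefree"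
begin

text \<open>
  Arithmetical functions are rendered as functions of type \<open>nat \<Rightarrow> complex\<close> of which only the
  values at positive arguments are relevant; no hypothesis below constrains \<open>F 0\<close>.
\<close>

definition completely_multiplicative :: "(nat \<Rightarrow> complex) \<Rightarrow> bool" where
  "completely_multiplicative F \<longleftrightarrow>
     F 1 = 1 \<and> (\<forall>m>0. \<forall>n>0. F (m * n) = F m * F n)"

definition bounded_arith :: "(nat \<Rightarrow> complex) \<Rightarrow> bool" where
  "bounded_arith F \<longleftrightarrow> bounded (F ` {0<..})"

text \<open>For \<open>n > 0\<close> the index set is finite; at \<open>n = 0\<close> the value is a dummy.\<close>

definition dirichlet_conv :: "(nat \<Rightarrow> complex) \<Rightarrow> (nat \<Rightarrow> complex) \<Rightarrow> nat \<Rightarrow> complex" where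
  "dirichlet_conv F G n = (\<Sum>(a, b) | a * b = n. F a * G b)"

definition is_dirichlet_inverse :: "(nat \<Rightarrow> complex) \<Rightarrow> (nat \<Rightarrow> complex) \<Rightarrow> bool" where
  "is_dirichlet_inverse F G \<longleftrightarrow>
     (\<forall>n>0. dirichlet_conv F G n = (if n = 1 then 1 else 0))"

text \<open>
  The condition \<open>G 0 = 0\<close> only fixes the irrelevant value at \<open>0\<close>, so that the inverse is unique
  as a function on \<open>nat\<close>. The definition is meaningful for \<open>F 1 \<noteq> 0\<close>, see
  \<open>ex1_dirichlet_inverse\<close>.
\<close>

definition dirichlet_inverse :: "(nat \<Rightarrow> complex) \<Rightarrow> nat \<Rightarrow> complex" where
  "dirichlet_inverse F = (THE G. G 0 = 0 \<and> is_dirichlet_inverse F G)"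

lemma dirichlet_conv_rec:
  assumes "n > 0"
  shows "dirichlet_conv F G n =
           F 1 * G n + (\<Sum>d | d dvd n \<and> d < n. F (n div d) * G d)"
proof -
  have "dirichlet_conv F G n = (\<Sum>d | d dvd n. F (n div d) * G d)"
    unfolding dirichlet_conv_def
    by (rule sum.reindex_bij_witness[of _ "\<lambda>d. (n div d, d)" snd]) (use assms in auto)
  also have "{d. d dvd n} = insert n {d. d dvd n \<and> d < n}"
    using assms by (auto dest: dvd_imp_le)
  also have "(\<Sum>d\<in>\<dots>. F (n div d) * G d) =
      F 1 * G n + (\<Sum>d | d dvd n \<and> d < n. F (n div d) * G d)"
    using assms by (subst sum.insert) auto
  finally show ?thesis .
qed

function dirichlet_inverse_rec :: "(nat \<Rightarrow> complex) \<Rightarrow> nat \<Rightarrow> complex" where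
  "dirichlet_inverse_rec F n =
     (if n = 0 then 0 else
      ((if n = 1 then 1 else 0) -
       (\<Sum>d | d dvd n \<and> d < n. F (n div d) * dirichlet_inverse_rec F d)) / F 1)"
  by auto
termination by (relation "Wellfounded.measure snd") auto

declare dirichlet_inverse_rec.simps [simp del]

lemma ex1_dirichlet_inverse:
  assumes "F 1 \<noteq> 0"
  shows "\<exists>!G. G 0 = 0 \<and> is_dirichlet_inverse F G"
proof (rule ex1I)
  let ?H = "dirichlet_inverse_rec F"
  show "?H 0 = 0 \<and> is_dirichlet_inverse F ?H"
    unfolding is_dirichlet_inverse_def
  proof (intro conjI allI impI)
    show "?H 0 = 0" by (simp add: dirichlet_inverse_rec.simps)
    fix n :: nat assume n: "n > 0"
    show "dirichlet_conv F ?H n = (if n = 1 then 1 else 0)"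
      unfolding dirichlet_conv_rec[OF n]
      using n assms by (subst dirichlet_inverse_rec.simps) (simp add: field_simps)
  qed
  fix G assume G: "G 0 = 0 \<and> is_dirichlet_inverse F G"
  have "G n = ?H n" for n
  proof (induction n rule: less_induct)
    case (less n)
    show ?case
    proof (cases "n = 0")
      case True
      then show ?thesis using G by (simp add: dirichlet_inverse_rec.simps)
    next
      case False
      then have n: "n > 0" by simp
      have "(\<Sum>d | d dvd n \<and> d < n. F (n div d) * G d) =
            (\<Sum>d | d dvd n \<and> d < n. F (n div d) * ?H d)"
        using less.IH by (intro sum.cong) auto
      moreover have "F 1 * G n + (\<Sum>d | d dvd n \<and> d < n. F (n div d) * G d) =
            (if n = 1 then 1 else 0)"
        using G n dirichlet_conv_rec[OF n, of F G] by (simp add: is_dirichlet_inverse_def)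
      ultimately have "F 1 * G n = (if n = 1 then 1 else 0) -
            (\<Sum>d | d dvd n \<and> d < n. F (n div d) * ?H d)"
        by (simp only: eq_diff_eq)
      then have "G n = ((if n = 1 then 1 else 0) -
            (\<Sum>d | d dvd n \<and> d < n. F (n div d) * ?H d)) / F 1"
        using assms by (metis nonzero_mult_div_cancel_left)
      then show ?thesis
        using n by (subst dirichlet_inverse_rec.simps) simp
    qed
  qed
  then show "G = ?H" by blast
qed

end

theory Submission
  imports Defs
begin

text \<open>
  Write a number that is not squarefree as \<open>n = q\<^sup>2 k\<close> with \<open>q > 1\<close>. A squarefree divisor of \<open>n\<close>
  already divides \<open>m = q k = n / q\<close>, because \<open>n\<close> divides \<open>m\<^sup>2\<close>. Hence, if an inverse \<open>G\<close> of \<open>F\<close> vanishes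
  at the proper divisors of \<open>n\<close> that are not squarefree, apart from
  \<open>G n\<close> only the divisors \<open>d\<close> of \<open>m\<close> contribute to the convolution \<open>(F * G)(n)\<close>. There \<open>F (n / d) = F q F (m / d)\<close>
  by complete multiplicativity, so that \<open>0 = (F * G)(n) = G n + F q (F * G)(m)\<close>. The last
  convolution vanishes because \<open>m > 1\<close>, hence \<open>G n = 0\<close>. Strong induction on \<open>n\<close> gives the claim.
\<close>

lemma dirichlet_conv_eq_sum_divisors:
  assumes "n > 0"
  shows "dirichlet_conv F G n = (\<Sum>d | d dvd n. F (n div d) * G d)"
  unfolding dirichlet_conv_def
  by (rule sum.reindex_bij_witness[of _ "\<lambda>d. (n div d, d)" snd]) (use assms in auto)

text \<open>
  With \<open>g = gcd d m\<close> and \<open>d = g e\<close>, the cofactor \<open>e\<close> is coprime to \<open>m / g\<close>, so \<open>d dvd m\<^sup>2\<close> forces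
  \<open>e dvd g\<close>. Then \<open>e\<^sup>2\<close> divides the squarefree \<open>d\<close>, which leaves only \<open>e = 1\<close>.
\<close>

lemma squarefree_dvd_square_imp_dvd:
  fixes d m :: nat
  assumes "squarefree d" and "d dvd m\<^sup>2"
  shows "d dvd m"
proof -
  define g where "g = gcd d m"
  have "d > 0" using assms(1) by (auto intro!: Nat.gr0I)
  then have "g > 0" by (simp add: g_def)
  then obtain e f where e: "d = e * g" and f: "m = f * g" and "coprime e f"
    unfolding g_def using gcd_coprime_exists[of d m] by auto
  have "e * g dvd (f\<^sup>2 * g) * g"
    using assms(2) by (simp add: e f power_mult_distrib power2_eq_square mult_ac)
  then have "e dvd f\<^sup>2 * g"
    using \<open>g > 0\<close> by simp
  with \<open>coprime e f\<close> have "e dvd g"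
    by (simp add: coprime_dvd_mult_right_iff)
  then have "e\<^sup>2 dvd d"
    by (simp add: e power2_eq_square)
  with assms(1) have "e dvd 1"
    by (rule squarefreeD)
  then show ?thesis by (simp add: e f)
qed

text \<open>
  Among the divisors \<open>d < q\<^sup>2 k\<close> only squarefree ones contribute, and these divide \<open>q k\<close>; conversely
  every divisor of \<open>q k\<close> is a proper divisor of \<open>q\<^sup>2 k\<close> as \<open>q > 1\<close>. Complete multiplicativity then
  splits off the common factor \<open>F q\<close>. The vanishing hypothesis on \<open>G\<close> is the form in which the
  induction hypothesis of the next lemma arrives.
\<close>

lemma dirichlet_conv_square_mult:
  assumes F: "completely_multiplicative F" and q: "q > 1" and k: "k > 0"
    and G: "\<And>d. d < q\<^sup>2 * k \<Longrightarrow> d > 0 \<Longrightarrow> \<not> squarefree d \<Longrightarrow> G d = 0"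
  shows "dirichlet_conv F G (q\<^sup>2 * k) = G (q\<^sup>2 * k) + F q * dirichlet_conv F G (q * k)"
proof -
  define m where "m = q * k"
  have n: "q\<^sup>2 * k = q * m" and m: "m > 0" "m < q * m"
    using q k by (simp_all add: m_def power2_eq_square)
  have m_sq: "q * m dvd m\<^sup>2"
    by (simp add: m_def power2_eq_square)
  have "(\<Sum>d | d dvd q * m \<and> d < q * m. F (q * m div d) * G d)
      = (\<Sum>d | d dvd m. F (q * m div d) * G d)"
  proof (rule sum.mono_neutral_right)
    show "{d. d dvd m} \<subseteq> {d. d dvd q * m \<and> d < q * m}"
      using m by (auto intro: le_less_trans[OF dvd_imp_le])
    show "\<forall>d\<in>{d. d dvd q * m \<and> d < q * m} - {d. d dvd m}. F (q * m div d) * G d = 0"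
    proof
      fix d assume d: "d \<in> {d. d dvd q * m \<and> d < q * m} - {d. d dvd m}"
      then have "\<not> squarefree d"
        using squarefree_dvd_square_imp_dvd[of d m] m_sq by (auto dest: dvd_trans)
      moreover have "d > 0"
        using d m by (auto intro!: Nat.gr0I)
      ultimately show "F (q * m div d) * G d = 0"
        using G d by (simp add: n)
    qed
  qed auto
  also have "\<dots> = (\<Sum>d | d dvd m. F q * (F (m div d) * G d))"
  proof (rule sum.cong)
    fix d assume "d \<in> {d. d dvd m}"
    then have "d dvd m" by simp
    then have "q * m div d = q * (m div d)" and "m div d > 0"
      using m by (auto simp: div_mult_swap elim!: dvdE)
    then show "F (q * m div d) * G d = F q * (F (m div d) * G d)"
      using F q by (simp add: completely_multiplicative_def)
  qed simp
  also have "\<dots> = F q * dirichlet_conv F G m"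
    using m by (simp add: dirichlet_conv_eq_sum_divisors sum_distrib_left)
  finally show ?thesis
    using F m by (simp add: n dirichlet_conv_rec completely_multiplicative_def flip: m_def)
qed

lemma is_dirichlet_inverse_eq_0_if_not_squarefree:
  assumes F: "completely_multiplicative F" and G: "is_dirichlet_inverse F G"
    and "n > 0" and "\<not> squarefree n"
  shows "G n = 0"
  using assms(3,4)
proof (induction n rule: less_induct)
  case (less n)
  then obtain q where "q\<^sup>2 dvd n" and "q \<noteq> 1"
    by (auto simp: squarefree_def)
  then obtain k where n: "n = q\<^sup>2 * k" by (elim dvdE)
  have q: "q > 1" and k: "k > 0"
    using less.prems \<open>q \<noteq> 1\<close> n by (auto simp: nat_neq_iff)
  have "dirichlet_conv F G n = G n + F q * dirichlet_conv F G (q * k)"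
    unfolding n using less.IH by (intro dirichlet_conv_square_mult F q k) (simp add: n)
  moreover have "dirichlet_conv F G n = 0"
    using G less.prems by (auto simp: is_dirichlet_inverse_def)
  moreover have "dirichlet_conv F G (q * k) = 0"
    using G q k by (auto simp: is_dirichlet_inverse_def)
  ultimately show ?case by simp
qed

lemma is_dirichlet_inverse_dirichlet_inverse:
  assumes "F 1 \<noteq> 0"
  shows "is_dirichlet_inverse F (dirichlet_inverse F)"
  using theI'[OF ex1_dirichlet_inverse[of F, OF assms]] by (simp add: dirichlet_inverse_def)

theorem theorem2p2:
  fixes F :: "nat \<Rightarrow> complex"
  assumes "bounded_arith F" and "completely_multiplicative F"
  shows "\<forall>n::nat. n > 0 \<and> \<not> squarefree n \<longrightarrow> dirichlet_inverse F n = 0"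
proof -
  have "is_dirichlet_inverse F (dirichlet_inverse F)"
    using assms(2)
    by (intro is_dirichlet_inverse_dirichlet_inverse) (simp add: completely_multiplicative_def)
  then show ?thesis
    using is_dirichlet_inverse_eq_0_if_not_squarefree[OF assms(2)] by blast
qed

end
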